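(* For every prime $p$, the group $D_8\times\mathbb{Z}_p$ is not a Schur group.
   Context: Notation: $\mathbb{Z}_n$ is the cyclic group of order $n$; $D_8$ is the dihedral group of order $8$. Let $G$ be a finite group with identity $e$. For $X\subseteq G$ put $\underline{X}=\sum_{x\in X}x\in\mathbb{Z}G$ and $X^{-1}=\{x^{-1}:x\in X\}$. A subring $\mathcal{A}\subseteq\mathbb{Z}G$ is an S-ring over $G$ if there is a partition $\mathcal{S}$ of $G$ such that (1) $\{e\}\in\mathcal{S}$; (2) $X\in\mathcal{S}$ implies $X^{-1}\in\mathcal{S}$; (3) $\mathcal{A}=\mathrm{Span}_{\mathbb{Z}}\{\underline{X}:X\in\mathcal{S}\}$. Let $G_r\leq\mathrm{Sym}(G)$ be the group of right translations of $G$. For $K\leq \mathrm{Sym}(G)$ with $K\geq G_r$, the $\mathbb{Z}$-module $V(K,G)=\mathrm{Span}_{\mathbb{Z}}\{\underline{X}: X \text{ is an orbit of } K_e \text{ on } G\}$, where $K_e$ is the stabilizer of $e$ in $K$, is an S-ring over $G$. An S-ring $\mathcal{A}$ over $G$ is schurian if $\mathcal{A}=V(K,G)$ for some $K$ with $G_r\leq K\leq\mathrm{Sym}(G)$. The group $G$ is a Schur group if every S-ring over $G$ is schurian. *)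

theory Defs
  imports
    "HOL-Algebra.Bij"
    "HOL-Algebra.Group_Action"
    "HOL-Algebra.Subrings"
    "HOL-Algebra.Elementary_Groups"
    "HOL-Library.Disjoint_Sets"
    "HOL-Library.Indicator_Function"
    "HOL-Computational_Algebra.Primes"
begin

text \<open>
  The integral group ring of a finite group \<open>G\<close>. An element \<open>\<Sum>x. f x \<cdot> x\<close> is its coefficient
  function \<open>f\<close>, with value 0 outside the carrier so that equality of functions is equality in
  the group ring. Multiplication is convolution.
\<close>

definition int_group_ring :: "('a, 'b) monoid_scheme \<Rightarrow> ('a \<Rightarrow> int) ring" where
  "int_group_ring G =
    \<lparr>carrier = {f. \<forall>x. x \<notin> carrier G \<longrightarrow> f x = 0},
     monoid.mult = (\<lambda>f g x. if x \<in> carrier G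
        then \<Sum>y\<in>carrier G. f y * g (inv\<^bsub>G\<^esub> y \<otimes>\<^bsub>G\<^esub> x) else 0),
     one = indicator {\<one>\<^bsub>G\<^esub>},
     zero = (\<lambda>x. 0),
     add = (\<lambda>f g x. f x + g x)\<rparr>"

text \<open>
  As an element of the group ring, the formal sum of a subset \<open>X\<close> of \<open>G\<close> is
  \<open>indicator X\<close>.
\<close>

definition int_span :: "('a \<Rightarrow> int) set \<Rightarrow> ('a \<Rightarrow> int) set" where
  "int_span B = {(\<lambda>x. \<Sum>b\<in>T. c b * b x) | T c. finite T \<and> T \<subseteq> B}"

definition S_ring :: "('a, 'b) monoid_scheme \<Rightarrow> ('a \<Rightarrow> int) set \<Rightarrow> bool" where
  "S_ring G A \<longleftrightarrow>
     subring A (int_group_ring G) \<and>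
     (\<exists>S. partition_on (carrier G) S \<and>
          {\<one>\<^bsub>G\<^esub>} \<in> S \<and>
          (\<forall>X\<in>S. (\<lambda>x. inv\<^bsub>G\<^esub> x) ` X \<in> S) \<and>
          A = int_span (indicator ` S))"

definition right_translations :: "('a, 'b) monoid_scheme \<Rightarrow> ('a \<Rightarrow> 'a) set" where
  "right_translations G = (\<lambda>g. \<lambda>x\<in>carrier G. x \<otimes>\<^bsub>G\<^esub> g) ` carrier G"

text \<open>
  \<open>BijGroup (carrier G)\<close> is Sym(G), and a permutation acts on \<open>G\<close> by itself, so
  the action argument of the stabilizer and of the orbits is the identity.
\<close>

definition transitivity_module ::
  "('a \<Rightarrow> 'a) set \<Rightarrow> ('a, 'b) monoid_scheme \<Rightarrow> ('a \<Rightarrow> int) set" where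
  "transitivity_module K G =
     (let Sym = BijGroup (carrier G);
          K\<^sub>e = stabilizer (Sym\<lparr>carrier := K\<rparr>) (\<lambda>k. k) \<one>\<^bsub>G\<^esub>
      in int_span (indicator ` orbits (Sym\<lparr>carrier := K\<^sub>e\<rparr>) (carrier G) (\<lambda>k. k)))"

definition schurian :: "('a, 'b) monoid_scheme \<Rightarrow> ('a \<Rightarrow> int) set \<Rightarrow> bool" where
  "schurian G A \<longleftrightarrow>
     (\<exists>K. subgroup K (BijGroup (carrier G)) \<and> right_translations G \<subseteq> K \<and>
          A = transitivity_module K G)"

definition Schur_group :: "('a, 'b) monoid_scheme \<Rightarrow> bool" where
  "Schur_group G \<longleftrightarrow> (\<forall>A. S_ring G A \<longrightarrow> schurian G A)"

text \<open>
  The dihedral group of order \<open>2 * n\<close>, for positive \<open>n\<close>: the pair \<open>(i, s)\<close> stands for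
  \<open>r\<^sup>i\<close> if \<open>s\<close> is false and for \<open>r\<^sup>i f\<close> if \<open>s\<close> is true, where \<open>r\<close> is the rotation of order
  \<open>n\<close> and \<open>f\<close> a reflection, \<open>f r f = r\<^sup>-\<^sup>1\<close>.
\<close>

definition dihedral_group :: "nat \<Rightarrow> (int \<times> bool) monoid" where
  "dihedral_group n =
    \<lparr>carrier = {0..<int n} \<times> UNIV,
     monoid.mult = (\<lambda>(i, s) (j, t). ((if s then i - j else i + j) mod int n, s \<noteq> t)),
     one = (0, False)\<rparr>"

abbreviation D\<^sub>8 :: "(int \<times> bool) monoid" where
  "D\<^sub>8 \<equiv> dihedral_group 4"

lemma group_dihedral_group:
  assumes "0 < n"
  shows "group (dihedral_group n)"
proof (rule groupI)
  fix x y z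
  assume "x \<in> carrier (dihedral_group n)" "y \<in> carrier (dihedral_group n)"
    "z \<in> carrier (dihedral_group n)"
  then show "x \<otimes>\<^bsub>dihedral_group n\<^esub> y \<otimes>\<^bsub>dihedral_group n\<^esub> z =
      x \<otimes>\<^bsub>dihedral_group n\<^esub> (y \<otimes>\<^bsub>dihedral_group n\<^esub> z)"
    by (auto simp: dihedral_group_def mod_simps algebra_simps)
next
  fix x
  assume x: "x \<in> carrier (dihedral_group n)"
  obtain i s where "x = (i, s)" by (cases x)
  then show "\<exists>y\<in>carrier (dihedral_group n). y \<otimes>\<^bsub>dihedral_group n\<^esub> x = \<one>\<^bsub>dihedral_group n\<^esub>"
    using x assms
    by (intro bexI[of _ "(if s then i else (- i) mod int n, s)"])
       (auto simp: dihedral_group_def mod_simps)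
qed (use assms in \<open>auto simp: dihedral_group_def split: if_splits\<close>)

lemma order_dihedral_group: "order (dihedral_group n) = 2 * n"
  by (simp add: order_def dihedral_group_def card_cartesian_product)

lemma ring_int_group_ring:
  fixes G (structure)
  assumes "group G" and fin: "finite (carrier G)"
  shows "ring (int_group_ring G)"
proof -
  interpret group G by fact
  have ab: "abelian_group (int_group_ring G)"
  proof (rule abelian_groupI)
    fix f assume "f \<in> carrier (int_group_ring G)"
    then show "\<exists>g\<in>carrier (int_group_ring G).
        g \<oplus>\<^bsub>int_group_ring G\<^esub> f = \<zero>\<^bsub>int_group_ring G\<^esub>"
      by (intro bexI[of _ "\<lambda>x. - f x"]) (auto simp: int_group_ring_def)
  qed (auto simp: int_group_ring_def algebra_simps)
  have conv: "(\<Sum>y\<in>carrier G. h (inv z \<otimes> y)) = (\<Sum>w\<in>carrier G. h w)"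
    if "z \<in> carrier G" for z and h :: "_ \<Rightarrow> int"
    by (rule sum.reindex_bij_witness[of _ "\<lambda>w. z \<otimes> w" "\<lambda>y. inv z \<otimes> y"])
       (use that in \<open>auto simp: m_assoc[symmetric]\<close>)
  have mon: "Group.monoid (int_group_ring G)"
  proof (rule monoidI)
    fix f g h
    assume "f \<in> carrier (int_group_ring G)" "g \<in> carrier (int_group_ring G)"
      "h \<in> carrier (int_group_ring G)"
    have "(\<Sum>y\<in>carrier G. (\<Sum>z\<in>carrier G. f z * g (inv z \<otimes> y)) * h (inv y \<otimes> x)) =
        (\<Sum>z\<in>carrier G. f z * (\<Sum>w\<in>carrier G. g w * h (inv w \<otimes> (inv z \<otimes> x))))"
      if x: "x \<in> carrier G" for x
    proof -
      have "(\<Sum>y\<in>carrier G. (\<Sum>z\<in>carrier G. f z * g (inv z \<otimes> y)) * h (inv y \<otimes> x)) =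
          (\<Sum>z\<in>carrier G. \<Sum>y\<in>carrier G. f z * g (inv z \<otimes> y) * h (inv y \<otimes> x))"
        by (subst sum.swap) (simp add: sum_distrib_right)
      also have "\<dots> = (\<Sum>z\<in>carrier G. f z *
          (\<Sum>y\<in>carrier G. g (inv z \<otimes> y) * h (inv (inv z \<otimes> y) \<otimes> (inv z \<otimes> x))))"
      proof (intro sum.cong refl)
        fix z assume z: "z \<in> carrier G"
        have "inv (inv z \<otimes> y) \<otimes> (inv z \<otimes> x) = inv y \<otimes> x" if y: "y \<in> carrier G" for y
        proof -
          have "inv (inv z \<otimes> y) \<otimes> (inv z \<otimes> x) = inv y \<otimes> (z \<otimes> (inv z \<otimes> x))"
            using x y z by (simp add: inv_mult_group m_assoc)
          also have "z \<otimes> (inv z \<otimes> x) = x"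
            using x z by (simp add: m_assoc[symmetric])
          finally show ?thesis .
        qed
        then show "(\<Sum>y\<in>carrier G. f z * g (inv z \<otimes> y) * h (inv y \<otimes> x)) = f z *
            (\<Sum>y\<in>carrier G. g (inv z \<otimes> y) * h (inv (inv z \<otimes> y) \<otimes> (inv z \<otimes> x)))"
          by (simp add: sum_distrib_left mult.assoc)
      qed
      also have "\<dots> = (\<Sum>z\<in>carrier G. f z *
          (\<Sum>w\<in>carrier G. g w * h (inv w \<otimes> (inv z \<otimes> x))))"
        by (intro sum.cong refl, subst conv[symmetric]) auto
      finally show ?thesis .
    qed
    then show "f \<otimes>\<^bsub>int_group_ring G\<^esub> g \<otimes>\<^bsub>int_group_ring G\<^esub> h =
        f \<otimes>\<^bsub>int_group_ring G\<^esub> (g \<otimes>\<^bsub>int_group_ring G\<^esub> h)"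
      by (auto simp: int_group_ring_def fun_eq_iff intro!: sum.cong)
  next
    fix f assume f: "f \<in> carrier (int_group_ring G)"
    have "(\<Sum>y\<in>carrier G. indicator {\<one>} y * f (inv y \<otimes> x)) = f x"
      if "x \<in> carrier G" for x
      using that fin by (simp add: indicator_def if_distrib if_distribR sum.delta cong: if_cong)
    then show "\<one>\<^bsub>int_group_ring G\<^esub> \<otimes>\<^bsub>int_group_ring G\<^esub> f = f"
      using f by (auto simp: int_group_ring_def fun_eq_iff)
    have "(\<Sum>y\<in>carrier G. f y * indicator {\<one>} (inv y \<otimes> x)) = f x"
      if x: "x \<in> carrier G" for x
    proof -
      have "inv y \<otimes> x = \<one> \<longleftrightarrow> y = x" if y: "y \<in> carrier G" for y
        using x y by (metis inv_closed inv_equality inv_inv l_inv)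
      then have "(\<Sum>y\<in>carrier G. f y * indicator {\<one>} (inv y \<otimes> x)) =
          (\<Sum>y\<in>carrier G. if y = x then f y else 0)"
        by (intro sum.cong) (auto simp: indicator_def)
      then show ?thesis using x fin by simp
    qed
    then show "f \<otimes>\<^bsub>int_group_ring G\<^esub> \<one>\<^bsub>int_group_ring G\<^esub> = f"
      using f by (auto simp: int_group_ring_def fun_eq_iff)
  qed (auto simp: int_group_ring_def indicator_def)
  show ?thesis
    by (rule ringI[OF ab mon])
       (auto simp: int_group_ring_def fun_eq_iff algebra_simps sum.distrib)
qed

end

theory Submission
  imports Defs "HOL-Library.Multiset"
begin

text \<open>
  An S-ring is encoded by a colouring of the group whose colour classes are the basic sets. If it
  is schurian, then any two elements \<open>x, x'\<close> of the same colour are related by a permutation that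
  fixes the identity, maps \<open>x\<close> to \<open>x'\<close> and preserves the colour of \<open>h g\<^sup>-\<^sup>1\<close> for all \<open>g, h\<close>.
  Non-schurity is shown by excluding such a permutation for one pair \<open>x, x'\<close>.

  Let \<open>z = r\<^sup>2\<close>, \<open>w = r f\<close> and \<open>V = {1, z, w, w z}\<close>, and let \<open>p\<close> be odd. Every basic set is a coset
  \<open>N x\<close> with \<open>N \<le> V\<close>. On \<open>V \<times> {c}\<close>, \<open>N\<close> is trivial for \<open>c = 0\<close> and \<open>\<langle>z\<rangle>\<close> otherwise; on \<open>V f \<times> {c}\<close>,
  \<open>N\<close> is \<open>\<langle>w\<rangle>\<close> for \<open>c = 1\<close>, \<open>\<langle>w z\<rangle>\<close> for \<open>c = -1\<close> and \<open>V\<close> otherwise. Suppose that a colour-preserving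
  permutation fixes the identity and maps \<open>(f, 0)\<close> to \<open>(r, 0)\<close>. Then it maps each \<open>(f, c)\<close> to
  \<open>(r\<^sup>\<plusminus>\<^sup>1, c)\<close>, and comparing \<open>(f, c)\<close> and \<open>(f, c + 2)\<close> with \<open>(1, c + 1)\<close> shows that the sign changes
  in every step from \<open>c\<close> to \<open>c + 2\<close>. After \<open>p\<close> steps this is a contradiction, as \<open>p\<close> is odd.

  For \<open>p = 2\<close> let \<open>c\<close> generate \<open>\<int>\<^sub>2\<close>. The basic sets are \<open>{1}\<close>, \<open>{c}\<close>, \<open>r\<^sup>i\<langle>c\<rangle>\<close> for \<open>i = 1, 2, 3\<close>,
  \<open>X = {f, r f c, r\<^sup>2 f c, r\<^sup>3 f c}\<close> and \<open>X c\<close>; the product \<open>X X\<close> is well behaved because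
  \<open>(1, -1, -1, -1)\<close> is the first row of a circulant Hadamard matrix. Here no colour-preserving
  permutation fixing the identity maps \<open>f c\<close> to \<open>r f\<close>.
\<close>

section \<open>Colourings and S-rings\<close>

text \<open>A pointwise condition takes the place of a span of indicator functions;
  \<open>colour_algebra_eq_int_span\<close> translates between the two.\<close>

definition colour_algebra ::
  "('a, 'b) monoid_scheme \<Rightarrow> ('a \<Rightarrow> 'c) \<Rightarrow> ('a \<Rightarrow> int) set" where
  "colour_algebra G col =
    {f. (\<forall>x. x \<notin> carrier G \<longrightarrow> f x = 0) \<and>
        (\<forall>x\<in>carrier G. \<forall>y\<in>carrier G. col x = col y \<longrightarrow> f x = f y)}"

definition colour_classes ::
  "('a, 'b) monoid_scheme \<Rightarrow> ('a \<Rightarrow> 'c) \<Rightarrow> 'a set set" where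
  "colour_classes G col = (\<lambda>x. {y \<in> carrier G. col y = col x}) ` carrier G"

lemma colour_algebraI:
  assumes "\<And>x. x \<notin> carrier G \<Longrightarrow> f x = 0"
    and "\<And>x y. x \<in> carrier G \<Longrightarrow> y \<in> carrier G \<Longrightarrow> col x = col y \<Longrightarrow> f x = f y"
  shows "f \<in> colour_algebra G col"
  using assms unfolding colour_algebra_def by blast

lemma colour_algebraD:
  assumes "f \<in> colour_algebra G col"
  shows "x \<notin> carrier G \<Longrightarrow> f x = 0"
    and "x \<in> carrier G \<Longrightarrow> y \<in> carrier G \<Longrightarrow> col x = col y \<Longrightarrow> f x = f y"
  using assms unfolding colour_algebra_def by blast+

section \<open>Colour algebras as integral spans of colour classes\<close>

lemma int_span_superset: "b \<in> B \<Longrightarrow> b \<in> int_span B"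
  unfolding int_span_def by (auto intro!: exI[of _ "{b}"] exI[of _ "\<lambda>_. 1"])

lemma int_span_cong:
  assumes "f \<in> int_span B" and "\<And>b. b \<in> B \<Longrightarrow> b x = b y"
  shows "f x = f y"
  using assms unfolding int_span_def by (auto intro!: sum.cong)

lemma colour_algebra_eq_int_span:
  assumes fin: "finite (carrier G)"
  shows "colour_algebra G col = int_span (indicator ` colour_classes G col)"
proof (intro equalityI subsetI)
  fix f assume f: "f \<in> colour_algebra G col"
  define T where "T = (indicator ` colour_classes G col :: ('a \<Rightarrow> int) set)"
  \<comment> \<open>The coefficient of a class is the value of \<open>f\<close> at an arbitrary
    element of it; \<open>b x = 1\<close> says that \<open>x\<close> lies in the class with
    indicator function \<open>b\<close>.\<close>
  define c where "c b = f (SOME x. x \<in> carrier G \<and> b x = 1)" for b :: "'a \<Rightarrow> int"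
  have T: "finite T" using fin by (simp add: T_def colour_classes_def)
  have "f x = (\<Sum>b\<in>T. c b * b x)" for x
  proof (cases "x \<in> carrier G")
    case False
    then have "b x = 0" if "b \<in> T" for b
      using that by (auto simp: T_def colour_classes_def)
    then show ?thesis using colour_algebraD(1)[OF f False] by (simp add: sum.neutral)
  next
    case True
    define b where "b = (indicator {y \<in> carrier G. col y = col x} :: 'a \<Rightarrow> int)"
    have b: "b \<in> T" using True by (auto simp: b_def T_def colour_classes_def)
    have zero: "b' x = 0" if "b' \<in> T" "b' \<noteq> b" for b'
    proof -
      obtain z where z: "z \<in> carrier G" "b' = indicator {y \<in> carrier G. col y = col z}"
        using \<open>b' \<in> T\<close> by (auto simp: T_def colour_classes_def)
      then have "col z \<noteq> col x" using \<open>b' \<noteq> b\<close> by (auto simp: b_def)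
      then show ?thesis using z by (simp add: indicator_def)
    qed
    have "(SOME y. y \<in> carrier G \<and> b y = 1) \<in> carrier G \<and>
        b (SOME y. y \<in> carrier G \<and> b y = 1) = 1"
      by (rule someI[of _ x]) (simp add: b_def True)
    then have "c b = f x"
      using True unfolding c_def
      by (intro colour_algebraD(2)[OF f]) (auto simp: b_def indicator_def split: if_splits)
    then have "c b * b x = f x" using True by (simp add: b_def)
    moreover have "(\<Sum>b\<in>T. c b * b x) = c b * b x"
    proof -
      have "(\<Sum>b'\<in>T - {b}. c b' * b' x) = 0" by (rule sum.neutral) (simp add: zero)
      then show ?thesis using T b by (simp add: sum.remove[of _ b])
    qed
    ultimately show ?thesis by simp
  qed
  then have "f = (\<lambda>x. \<Sum>b\<in>T. c b * b x)" by auto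
  then show "f \<in> int_span (indicator ` colour_classes G col)"
    using T unfolding int_span_def T_def by blast
next
  fix f :: "'a \<Rightarrow> int" assume f: "f \<in> int_span (indicator ` colour_classes G col)"
  have "f x = 0" if "x \<notin> carrier G" for x
    using f that by (fastforce simp: int_span_def colour_classes_def intro!: sum.neutral)
  moreover have "f x = f y" if "x \<in> carrier G" "y \<in> carrier G" "col x = col y" for x y
    by (rule int_span_cong[OF f]) (use that in \<open>auto simp: colour_classes_def indicator_def\<close>)
  ultimately show "f \<in> colour_algebra G col"
    unfolding colour_algebra_def by blast
qed

text \<open>The multiset in \<open>mult\<close> lists the colours of both factors over all
  factorizations \<open>x = y (y^-1 x)\<close>. Its multiplicities are the structure constants; as
  they depend only on the colour of \<open>x\<close>, products of basic sums are again combinations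
  of basic sums.\<close>

lemma S_ring_colour_algebra:
  fixes G (structure)
  assumes "group G" and fin: "finite (carrier G)"
    and one: "\<And>x. x \<in> carrier G \<Longrightarrow> col x = col \<one> \<Longrightarrow> x = \<one>"
    and inv: "\<And>x y. x \<in> carrier G \<Longrightarrow> y \<in> carrier G \<Longrightarrow> col x = col y \<Longrightarrow>
      col (inv x) = col (inv y)"
    and mult: "\<And>x x'. x \<in> carrier G \<Longrightarrow> x' \<in> carrier G \<Longrightarrow> col x = col x' \<Longrightarrow>
      image_mset (\<lambda>y. (col y, col (inv y \<otimes> x))) (mset_set (carrier G)) =
      image_mset (\<lambda>y. (col y, col (inv y \<otimes> x'))) (mset_set (carrier G))"
  shows "S_ring G (colour_algebra G col)"
  unfolding S_ring_def
proof (intro conjI exI)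
  interpret group G by fact
  interpret R: ring "int_group_ring G" by (rule ring_int_group_ring) fact+
  have closed: "f \<otimes>\<^bsub>int_group_ring G\<^esub> g \<in> colour_algebra G col"
    if f: "f \<in> colour_algebra G col" and g: "g \<in> colour_algebra G col" for f g
  proof -
    \<comment> \<open>\<open>F h k\<close> is the value of \<open>h\<close> on colour
      \<open>k\<close>. It turns a convolution into a sum over the multiset of colour pairs.\<close>
    define F where "F h k = h (SOME x. x \<in> carrier G \<and> col x = k)" for h :: "'a \<Rightarrow> int" and k
    have F: "h x = F h (col x)" if "h \<in> colour_algebra G col" "x \<in> carrier G" for h x
    proof -
      have "(SOME y. y \<in> carrier G \<and> col y = col x) \<in> carrier G \<and>
          col (SOME y. y \<in> carrier G \<and> col y = col x) = col x"
        by (rule someI[of _ x]) (simp add: that)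
      then show ?thesis unfolding F_def by (intro colour_algebraD(2)[OF that(1)]) (auto simp: that)
    qed
    have conv: "(\<Sum>y\<in>carrier G. f y * g (inv y \<otimes> x)) =
        (\<Sum>(k, l)\<in>#image_mset (\<lambda>y. (col y, col (inv y \<otimes> x))) (mset_set (carrier G)). F f k * F g l)"
      if "x \<in> carrier G" for x
    proof -
      have "(\<Sum>y\<in>carrier G. f y * g (inv y \<otimes> x)) =
          (\<Sum>y\<in>carrier G. F f (col y) * F g (col (inv y \<otimes> x)))"
        using that by (intro sum.cong refl arg_cong2[of _ _ _ _ "(*)"] F f g) auto
      also have "\<dots> = (\<Sum>(k, l)\<in>#image_mset (\<lambda>y. (col y, col (inv y \<otimes> x))) (mset_set (carrier G)).
          F f k * F g l)"
        by (simp add: sum_unfold_sum_mset multiset.map_comp comp_def)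
      finally show ?thesis .
    qed
    have const: "(\<Sum>y\<in>carrier G. f y * g (inv y \<otimes> x)) = (\<Sum>y\<in>carrier G. f y * g (inv y \<otimes> x'))"
      if "x \<in> carrier G" "x' \<in> carrier G" "col x = col x'" for x x'
      using conv[OF that(1)] conv[OF that(2)] mult[OF that] by presburger
    show ?thesis
      unfolding colour_algebra_def int_group_ring_def
      by (auto intro: const)
  qed
  show "subring (colour_algebra G col) (int_group_ring G)"
  proof (rule R.subringI)
    show "\<one>\<^bsub>int_group_ring G\<^esub> \<in> colour_algebra G col"
      using one by (fastforce simp: colour_algebra_def int_group_ring_def indicator_def)
  next
    fix f assume f: "f \<in> colour_algebra G col"
    then have "\<ominus>\<^bsub>int_group_ring G\<^esub> f = (\<lambda>x. - f x)"
      by (intro R.minus_equality) (auto simp: int_group_ring_def colour_algebra_def)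
    moreover have "(\<lambda>x. - f x) \<in> colour_algebra G col"
      by (intro colour_algebraI arg_cong[of _ _ uminus])
         (blast intro: colour_algebraD(2)[OF f] | simp add: colour_algebraD(1)[OF f])+
    ultimately show "\<ominus>\<^bsub>int_group_ring G\<^esub> f \<in> colour_algebra G col" by simp
  next
    fix f g assume f: "f \<in> colour_algebra G col" and g: "g \<in> colour_algebra G col"
    have "(\<lambda>x. f x + g x) \<in> colour_algebra G col"
      by (intro colour_algebraI arg_cong2[of _ _ _ _ "(+)"])
         (blast intro: colour_algebraD(2)[OF f] colour_algebraD(2)[OF g] |
          simp add: colour_algebraD(1)[OF f] colour_algebraD(1)[OF g])+
    then show "f \<oplus>\<^bsub>int_group_ring G\<^esub> g \<in> colour_algebra G col"
      by (simp add: int_group_ring_def)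
  qed (use closed colour_algebraD(1) in \<open>fastforce simp: int_group_ring_def\<close>)+
  show "partition_on (carrier G) (colour_classes G col)"
    by (rule partition_onI) (auto simp: colour_classes_def disjnt_def)
  show "{\<one>} \<in> colour_classes G col"
    using one by (auto simp: colour_classes_def intro!: image_eqI[of _ _ \<one>])
  show "\<forall>X\<in>colour_classes G col. (\<lambda>x. inv x) ` X \<in> colour_classes G col"
  proof
    fix X assume "X \<in> colour_classes G col"
    then obtain x where x: "x \<in> carrier G" "X = {y \<in> carrier G. col y = col x}"
      by (auto simp: colour_classes_def)
    have "(\<lambda>x. inv x) ` X = {y \<in> carrier G. col y = col (inv x)}"
    proof (intro equalityI subsetI)
      fix y assume "y \<in> {y \<in> carrier G. col y = col (inv x)}"
      then have "inv y \<in> X" "y = inv (inv y)"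
        using x(1) inv[of y "inv x"] unfolding x(2) by simp_all
      then show "y \<in> (\<lambda>x. inv x) ` X" by blast
    next
      fix y assume "y \<in> (\<lambda>x. inv x) ` X"
      then show "y \<in> {y \<in> carrier G. col y = col (inv x)}"
        using x(1) unfolding x(2) by (blast intro: inv)
    qed
    then show "(\<lambda>x. inv x) ` X \<in> colour_classes G col"
      using x by (auto simp: colour_classes_def)
  qed
  show "colour_algebra G col = int_span (indicator ` colour_classes G col)"
    by (rule colour_algebra_eq_int_span) fact
qed

text \<open>A permutation of \<open>A\<close> that carries \<open>f\<close> to \<open>g\<close> only
  reindexes the multiset. The inverse is given explicitly so that every hypothesis is a pointwise
  check.\<close>

lemma image_mset_bij_cong:
  assumes "\<And>y. y \<in> A \<Longrightarrow> \<sigma> y \<in> A" and "\<And>y. y \<in> A \<Longrightarrow> \<sigma>' y \<in> A"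
    and "\<And>y. y \<in> A \<Longrightarrow> \<sigma>' (\<sigma> y) = y" and "\<And>y. y \<in> A \<Longrightarrow> \<sigma> (\<sigma>' y) = y"
    and g: "\<And>y. y \<in> A \<Longrightarrow> g (\<sigma> y) = f y"
  shows "image_mset f (mset_set A) = image_mset g (mset_set A)"
\<comment> \<open>For infinite \<open>A\<close>, \<open>mset_set A\<close> is empty by
  convention.\<close>
proof (cases "finite A")
  case True
  have "bij_betw \<sigma> A A" by (rule bij_betwI[of _ _ _ \<sigma>']) (use assms in auto)
  then have "image_mset g (mset_set A) = image_mset g (image_mset \<sigma> (mset_set A))"
    by (simp add: bij_betw_def image_mset_mset_set)
  also have "\<dots> = image_mset f (mset_set A)"
    unfolding multiset.map_comp using True g by (intro image_mset_cong) auto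
  finally show ?thesis by simp
qed simp

text \<open>The colour classes are the orbits of the stabilizer of the identity in \<open>K\<close>,
  so some \<open>k\<close> in it maps \<open>x\<close> to \<open>x'\<close>. For each
  \<open>g\<close>, the map sending \<open>y\<close> to \<open>k (y g) (k g)^-1\<close> lies in
  \<open>K\<close> and fixes the identity, hence preserves colours; \<open>y = h g^-1\<close> gives
  the claim.\<close>

lemma schurian_colour_algebraD:
  fixes G (structure)
  assumes "group G" and fin: "finite (carrier G)"
    and schurian: "schurian G (colour_algebra G col)"
    and x: "x \<in> carrier G" and x': "x' \<in> carrier G" and col: "col x = col x'"
  obtains k where "k \<in> carrier G \<rightarrow> carrier G" and "k \<one> = \<one>" and "k x = x'"
    and "\<And>g h. g \<in> carrier G \<Longrightarrow> h \<in> carrier G \<Longrightarrow> col (k h \<otimes> inv (k g)) = col (h \<otimes> inv g)"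
proof -
  interpret group G by fact
  define Sym where "Sym = BijGroup (carrier G)"
  interpret Sym: group Sym unfolding Sym_def by (rule group_BijGroup)
  obtain K where K: "subgroup K Sym" and R: "right_translations G \<subseteq> K"
    and eq: "colour_algebra G col = transitivity_module K G"
    using schurian by (auto simp: schurian_def Sym_def)
  define Ke where "Ke = stabilizer (Sym\<lparr>carrier := K\<rparr>) (\<lambda>k. k) \<one>"
  have Ke_iff: "k \<in> Ke \<longleftrightarrow> k \<in> K \<and> k \<one> = \<one>" for k
    by (simp add: Ke_def stabilizer_def)
  have action: "group_action (Sym\<lparr>carrier := H\<rparr>) (carrier G) (\<lambda>k. k)" if "subgroup H Sym" for H
    unfolding group_action_def Sym_def[symmetric]
    using subgroup.subgroup_is_group[OF that] subgroup.subset[OF that]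
    by (intro group_hom.intro group_hom_axioms.intro) (auto simp: hom_def)
  have "subgroup Ke (Sym\<lparr>carrier := K\<rparr>)"
    unfolding Ke_def by (rule group_action.stabilizer_subgroup[OF action[OF K]]) simp
  then have "subgroup Ke Sym"
    using K Sym.incl_subgroup by blast
  then interpret Ke: group_action "Sym\<lparr>carrier := Ke\<rparr>" "carrier G" "\<lambda>k. k"
    by (rule action)
  define orb where "orb = orbit (Sym\<lparr>carrier := Ke\<rparr>) (\<lambda>k. k)"
  have orb_iff: "y \<in> orb z \<longleftrightarrow> (\<exists>k\<in>Ke. y = k z)" for y z
    by (auto simp: orb_def orbit_def)
  have span: "colour_algebra G col = int_span (indicator ` (orb ` carrier G))"
    unfolding eq transitivity_module_def Let_def Sym_def[symmetric] Ke_def[symmetric]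
    by (simp add: orbits_def orb_def image_def Setcompr_eq_image)
  have K_closed: "k y \<in> carrier G" if "k \<in> K" "y \<in> carrier G" for k y
    using subgroup.subset[OF K] that Bij_imp_funcset
    by (fastforce simp: Sym_def BijGroup_def)
  have K_comp: "(\<lambda>y\<in>carrier G. k (l y)) \<in> K" if "k \<in> K" "l \<in> K" for k l
    using subgroup.m_closed[OF K that] that subgroup.subset[OF K]
    by (simp add: Sym_def BijGroup_def compose_def subset_iff)
  \<comment> \<open>The indicator function of a colour class is a combination of those of orbits, so
    it is constant on orbits.\<close>
  have col_Ke: "col (k y) = col y" if k: "k \<in> Ke" and y: "y \<in> carrier G" for k y
  proof -
    have ky: "k y \<in> carrier G" using k y K_closed Ke_iff by auto
    have same: "y \<in> orb z \<longleftrightarrow> k y \<in> orb z" if z: "z \<in> carrier G" for z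
    proof -
      have "k y \<in> orb y" using k orb_iff by blast
      moreover have "y \<in> orb (k y)"
        using calculation Ke.orbit_sym[of y "k y"] y ky by (simp add: orb_def)
      ultimately show ?thesis
        using Ke.orbit_trans[of z y "k y"] Ke.orbit_trans[of z "k y" y] y ky z
        unfolding orb_def by blast
    qed
    have "(indicator {u \<in> carrier G. col u = col y} :: 'a \<Rightarrow> int) \<in> colour_algebra G col"
      by (auto simp: colour_algebra_def indicator_def)
    then have "(indicator {u \<in> carrier G. col u = col y} :: 'a \<Rightarrow> int) y =
        indicator {u \<in> carrier G. col u = col y} (k y)"
      unfolding span by (rule int_span_cong) (use same in \<open>auto simp: indicator_def\<close>)
    then show ?thesis using y by (auto simp: indicator_def split: if_splits)
  qed
  \<comment> \<open>Conversely, the indicator function of an orbit is constant on colours, so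
    elements of one colour share an orbit.\<close>
  have "(indicator (orb x) :: 'a \<Rightarrow> int) \<in> colour_algebra G col"
    unfolding span using x by (intro int_span_superset) auto
  then have "(indicator (orb x) :: 'a \<Rightarrow> int) x = indicator (orb x) x'"
    using x x' col unfolding colour_algebra_def by blast
  moreover have "x \<in> orb x"
    using Ke.orbit_refl[OF x] by (simp add: orb_def)
  ultimately have "x' \<in> orb x" by (simp add: indicator_def split: if_splits)
  then obtain k where k: "k \<in> Ke" "k x = x'" unfolding orb_iff by blast
  have kK: "k \<in> K" using k Ke_iff by blast
  have "col (k h \<otimes> inv (k g)) = col (h \<otimes> inv g)"
    if g: "g \<in> carrier G" and h: "h \<in> carrier G" for g h
  proof -
    note kg = K_closed[OF kK g] and kh = K_closed[OF kK h]
    define \<rho> where "\<rho> a = (\<lambda>y\<in>carrier G. y \<otimes> a)" for a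
    have \<rho>: "\<rho> a \<in> K" if "a \<in> carrier G" for a
      using R that by (auto simp: right_translations_def \<rho>_def)
    define l where "l = (\<lambda>y\<in>carrier G. \<rho> (inv (k g)) ((\<lambda>y\<in>carrier G. k (\<rho> g y)) y))"
    have lK: "l \<in> K" unfolding l_def using g kg kK by (intro K_comp \<rho>) auto
    have l: "l y = k (y \<otimes> g) \<otimes> inv (k g)" if "y \<in> carrier G" for y
      using that g kg K_closed[OF kK, of "y \<otimes> g"] by (simp add: l_def \<rho>_def)
    have "l \<in> Ke" using lK l[of \<one>] g kg by (simp add: Ke_iff)
    then have "col (l (h \<otimes> inv g)) = col (h \<otimes> inv g)" using g h by (intro col_Ke) auto
    moreover have "l (h \<otimes> inv g) = k h \<otimes> inv (k g)"
      using l[of "h \<otimes> inv g"] g h by (simp add: m_assoc)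
    ultimately show ?thesis by simp
  qed
  then show ?thesis using k K_closed[OF kK] by (intro that[of k]) (auto simp: Ke_iff)
qed

section \<open>The groups \<open>D\<^sub>8 \<times> \<int>\<^sub>p\<close>\<close>

abbreviation D8_times_Z :: "nat \<Rightarrow> ((int \<times> bool) \<times> int) monoid" where
  "D8_times_Z p \<equiv> D\<^sub>8 \<times>\<times> integer_mod_group p"

lemma group_D8_times_Z: "group (D8_times_Z p)"
  by (simp add: DirProd_group group_dihedral_group)

lemma carrier_D8_times_Z:
  "0 < p \<Longrightarrow> carrier (D8_times_Z p) = ({0, 1, 2, 3} \<times> UNIV) \<times> {0..<int p}"
  by (auto simp: dihedral_group_def carrier_integer_mod_group)

lemma inv_D\<^sub>8:
  assumes "i \<in> {0..<4}"
  shows "inv\<^bsub>D\<^sub>8\<^esub> (i, s) = ((if s then i else - i) mod 4, s)"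
  by (rule group.inv_equality[OF group_dihedral_group])
     (use assms in \<open>auto simp: dihedral_group_def mod_simps\<close>)

lemma inv_D8_times_Z:
  assumes "((i, s), c) \<in> carrier (D8_times_Z p)"
  shows "inv\<^bsub>D8_times_Z p\<^esub> ((i, s), c) = (((if s then i else - i) mod 4, s), - c mod int p)"
proof -
  have "i \<in> {0..<4}" using assms by (simp add: dihedral_group_def)
  then show ?thesis
    using assms inv_D\<^sub>8[of i s] by (simp add: group_dihedral_group)
qed

lemma inv_mult_D8_times_Z:
  assumes "((j, u), d) \<in> carrier (D8_times_Z p)"
  shows "inv\<^bsub>D8_times_Z p\<^esub> ((j, u), d) \<otimes>\<^bsub>D8_times_Z p\<^esub> ((i, s), c) =
    (((if u then j - i else i - j) mod 4, u \<noteq> s), (c - d) mod int p)"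
  unfolding inv_D8_times_Z[OF assms]
  by (simp add: dihedral_group_def mod_simps)

lemma mult_inv_D8_times_Z:
  assumes "((j, u), d) \<in> carrier (D8_times_Z p)"
  shows "((i, s), c) \<otimes>\<^bsub>D8_times_Z p\<^esub> inv\<^bsub>D8_times_Z p\<^esub> ((j, u), d) =
    (((if s = u then i - j else i + j) mod 4, s \<noteq> u), (c - d) mod int p)"
  unfolding inv_D8_times_Z[OF assms]
  by (simp add: dihedral_group_def mod_simps)

text \<open>Coordinate form of \<open>schurian_colour_algebraD\<close>. The images enter through
  equations, so that an image found so far can be supplied as a fact.\<close>

lemma schurian_D8_times_ZD:
  assumes p: "0 < p"
    and schurian: "schurian (D8_times_Z p) (colour_algebra (D8_times_Z p) col)"
    and x: "x \<in> carrier (D8_times_Z p)" "x' \<in> carrier (D8_times_Z p)" "col x = col x'"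
  obtains k where "k \<in> carrier (D8_times_Z p) \<rightarrow> carrier (D8_times_Z p)"
    and "k ((0, False), 0) = ((0, False), 0)" and "k x = x'"
    and "\<And>i s c i' s' c' j u d j' u' d'.
      \<lbrakk>k ((i, s), c) = ((i', s'), c'); k ((j, u), d) = ((j', u'), d');
       ((i, s), c) \<in> carrier (D8_times_Z p); ((j, u), d) \<in> carrier (D8_times_Z p)\<rbrakk> \<Longrightarrow>
      col (((if s' = u' then i' - j' else i' + j') mod 4, s' \<noteq> u'), (c' - d') mod int p) =
      col (((if s = u then i - j else i + j) mod 4, s \<noteq> u), (c - d) mod int p)"
proof -
  let ?G = "D8_times_Z p"
  have fin: "finite (carrier ?G)" unfolding carrier_D8_times_Z[OF p] by simp
  obtain k where k_closed: "k \<in> carrier ?G \<rightarrow> carrier ?G" and k_one: "k \<one>\<^bsub>?G\<^esub> = \<one>\<^bsub>?G\<^esub>"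
    and k_x: "k x = x'"
    and k: "\<And>g h. g \<in> carrier ?G \<Longrightarrow> h \<in> carrier ?G \<Longrightarrow>
      col (k h \<otimes>\<^bsub>?G\<^esub> inv\<^bsub>?G\<^esub> (k g)) = col (h \<otimes>\<^bsub>?G\<^esub> inv\<^bsub>?G\<^esub> g)"
    by (rule schurian_colour_algebraD[OF group_D8_times_Z fin schurian x]) blast
  have one: "\<one>\<^bsub>?G\<^esub> = ((0, False), 0)" by (simp add: dihedral_group_def)
  show ?thesis
  proof (rule that[OF k_closed k_one[unfolded one] k_x])
    fix i s c i' s' c' j u d j' u' d'
    assume img: "k ((i, s), c) = ((i', s'), c')" "k ((j, u), d) = ((j', u'), d')"
      and mem: "((i, s), c) \<in> carrier ?G" "((j, u), d) \<in> carrier ?G"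
    have "((j', u'), d') \<in> carrier ?G" using k_closed img mem by (metis PiE)
    then show "col (((if s' = u' then i' - j' else i' + j') mod 4, s' \<noteq> u'), (c' - d') mod int p) =
        col (((if s = u then i - j else i + j) mod 4, s \<noteq> u), (c - d) mod int p)"
      using k[OF mem(2,1)] unfolding img
      by (simp only: mult_inv_D8_times_Z mem(2))
  qed
qed

section \<open>Odd primes\<close>

text \<open>The second component separates \<open>V\<close> from \<open>V f\<close>; the third
  labels the cosets of \<open>N\<close>. On \<open>V f\<close>, halving \<open>i\<close> pairs
  \<open>f\<close> with \<open>r\<close> (cosets of \<langle>w\<rangle>), and halving after the
  shift by 1 pairs \<open>f\<close> with \<open>r^3\<close> (cosets of \<langle>w
  z\<rangle>).\<close>

definition twisted_colour :: "nat \<Rightarrow> (int \<times> bool) \<times> int \<Rightarrow> int \<times> bool \<times> int" where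
  "twisted_colour p = (\<lambda>((i, s), c). (c, odd i \<noteq> s,
     if odd i = s then if c = 0 then i else i mod 2
     else if c = 1 then i div 2
     else if c = int p - 1 then (i + 1) mod 4 div 2
     else 0))"

text \<open>
  \<open>klein t\<close> for \<open>t = 0, 1, 2, 3\<close> is \<open>1, w, z, w z\<close>, \<open>klein_add\<close> is the product of \<open>V\<close> in these
  indices, and \<open>klein_stab p v c\<close> is the subgroup \<open>N\<close> on \<open>V \<times> {c}\<close> if \<open>v\<close> holds and on \<open>V f \<times> {c}\<close>
  otherwise. An element \<open>(i, s)\<close> of the dihedral group lies in \<open>V\<close> iff \<open>odd i = s\<close>.
\<close>

definition klein_add :: "int \<Rightarrow> int \<Rightarrow> int" where
  "klein_add r t = (if odd r then r - t else r + t) mod 4"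

definition klein :: "int \<Rightarrow> (int \<times> bool) \<times> int" where
  "klein t = ((t, odd t), 0)"

definition klein_stab :: "nat \<Rightarrow> bool \<Rightarrow> int \<Rightarrow> int set" where
  "klein_stab p v c =
    (if v then if c = 0 then {0} else {0, 2}
     else if c = 1 then {0, 1}
     else if c = int p - 1 then {0, 3}
     else {0, 1, 2, 3})"

section \<open>Arithmetic of the Klein four-group \<open>V\<close> in indices\<close>

lemma klein_stab_subset: "klein_stab p v c \<subseteq> {0, 1, 2, 3}"
  by (simp add: klein_stab_def)

lemma klein_closed: "0 < p \<Longrightarrow> t \<in> {0, 1, 2, 3} \<Longrightarrow> klein t \<in> carrier (D8_times_Z p)"
  by (auto simp: klein_def carrier_D8_times_Z simp del: carrier_DirProd)

lemma klein_add_closed: "klein_add r t \<in> {0, 1, 2, 3}"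
  unfolding klein_add_def by (simp; presburger)

lemma klein_mult:
  assumes "((i, s), c) \<in> carrier (D8_times_Z p)"
  shows "klein t \<otimes>\<^bsub>D8_times_Z p\<^esub> ((i, s), c) = ((klein_add t i, odd t \<noteq> s), c)"
  using assms
  by (cases "p = 0") (auto simp: klein_def klein_add_def dihedral_group_def carrier_integer_mod_group)

lemma klein_mult_klein:
  assumes "0 < p" and "t \<in> {0, 1, 2, 3}"
  shows "klein r \<otimes>\<^bsub>D8_times_Z p\<^esub> klein t = klein (klein_add r t)"
proof -
  have "odd (klein_add r t) \<longleftrightarrow> odd r \<noteq> odd t"
    unfolding klein_add_def by presburger
  then show ?thesis
    using klein_mult[OF klein_closed[OF assms, unfolded klein_def], of r]
    by (simp add: klein_def)
qed

lemma inv_klein: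
  assumes "0 < p" and "t \<in> {0, 1, 2, 3}"
  shows "inv\<^bsub>D8_times_Z p\<^esub> (klein t) = klein t"
proof (rule group.inv_equality[OF group_D8_times_Z])
  show "klein t \<otimes>\<^bsub>D8_times_Z p\<^esub> klein t = \<one>\<^bsub>D8_times_Z p\<^esub>"
    using assms by (subst klein_mult_klein) (auto simp: klein_def klein_add_def dihedral_group_def)
qed (use klein_closed[OF assms] in auto)

text \<open>\<open>V\<close> is abelian, while elements of \<open>V f\<close> interchange
  \<open>w\<close> and \<open>w z\<close> by conjugation; on indices this is negation modulo
  4.\<close>

lemma klein_conj:
  assumes "((j, u), d) \<in> carrier (D8_times_Z p)" and t: "t \<in> {0, 1, 2, 3}" and p: "0 < p"
  shows "klein t \<otimes>\<^bsub>D8_times_Z p\<^esub> ((j, u), d) =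
    ((j, u), d) \<otimes>\<^bsub>D8_times_Z p\<^esub> klein (if odd j = u then t else - t mod 4)"
  unfolding klein_mult[OF assms(1)]
  using assms unfolding carrier_D8_times_Z[OF p]
  by (cases u) (auto simp: klein_def klein_add_def dihedral_group_def)

text \<open>Together with \<open>twisted_colour_eqD\<close> this identifies the colour classes with
  the cosets \<open>N x\<close>, so that later arguments can use \<open>N\<close> in place of the
  colour formula.\<close>

lemma twisted_colour_klein_mult:
  assumes p: "2 < p" and x: "((i, s), c) \<in> carrier (D8_times_Z p)"
    and t: "t \<in> klein_stab p (odd i = s) c"
  shows "twisted_colour p (klein t \<otimes>\<^bsub>D8_times_Z p\<^esub> ((i, s), c)) = twisted_colour p ((i, s), c)"
proof -
  have i: "i \<in> {0, 1, 2, 3}" using p x by (simp add: carrier_D8_times_Z del: carrier_DirProd)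
  show ?thesis
    unfolding klein_mult[OF x] using p i t
    by (cases s) (auto simp: twisted_colour_def klein_add_def klein_stab_def split: if_splits)
qed

lemma twisted_colour_eqD:
  assumes p: "2 < p" and x: "((i, s), c) \<in> carrier (D8_times_Z p)"
    and x': "((i', s'), c') \<in> carrier (D8_times_Z p)"
    and eq: "twisted_colour p ((i, s), c) = twisted_colour p ((i', s'), c')"
  obtains t where "t \<in> klein_stab p (odd i = s) c"
    and "((i', s'), c') = klein t \<otimes>\<^bsub>D8_times_Z p\<^esub> ((i, s), c)"
proof
  \<comment> \<open>This is the index of the quotient of the second element by the first.\<close>
  define t where "t = (if s = s' then i' - i else i' + i) mod 4"
  have i: "i \<in> {0, 1, 2, 3}" "i' \<in> {0, 1, 2, 3}"
    using p x x' by (simp_all add: carrier_D8_times_Z del: carrier_DirProd)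
  have v: "(odd i \<noteq> s) = (odd i' \<noteq> s')" and c: "c' = c"
    using eq by (simp_all add: twisted_colour_def)
  show "t \<in> klein_stab p (odd i = s) c"
  proof (cases "odd i = s")
    case True
    then have "s = odd i" "s' = odd i'" using v by auto
    with eq i c show ?thesis
      by (auto simp: twisted_colour_def klein_stab_def t_def split: if_splits)
  next
    case False
    then have s: "s = even i" "s' = even i'" using v by auto
    consider "c = 1" | "c \<noteq> 1" "c = int p - 1" | "c \<noteq> 1" "c \<noteq> int p - 1" by blast
    then show ?thesis
    proof cases
      case 3
      then show ?thesis using i s by (auto simp: klein_stab_def t_def)
    qed (use eq i c s in \<open>auto simp: twisted_colour_def klein_stab_def t_def\<close>)
  qed
  show "((i', s'), c') = klein t \<otimes>\<^bsub>D8_times_Z p\<^esub> ((i, s), c)"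
    unfolding klein_mult[OF x] using i v c
    by (cases s; cases s') (auto simp: t_def klein_add_def)
qed

text \<open>\<open>N\<close> on a product of two cosets \<open>V y\<close> and \<open>V y'\<close>
  is contained in the product of \<open>N\<close> on \<open>V y\<close> with the conjugate by
  \<open>y\<close> of \<open>N\<close> on \<open>V y'\<close>. The negation for \<open>y\<close> in
  \<open>V f\<close> is this conjugation.\<close>

lemma klein_stab_mult:
  assumes p: "2 < p" and d: "d \<in> {0..<int p}" and e: "e \<in> {0..<int p}"
    and t: "t \<in> klein_stab p (v = v') ((d + e) mod int p)"
  shows "\<exists>r \<in> klein_stab p v d.
    (if v then klein_add r t else - klein_add r t mod 4) \<in> klein_stab p v' e"
proof -
  define c n where "c = (d + e) mod int p" and "n = int p - 1"
  have c: "d = 0 \<Longrightarrow> c = e" "e = 0 \<Longrightarrow> c = d" "d = 1 \<Longrightarrow> e = n \<Longrightarrow> c = 0"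
    "d = n \<Longrightarrow> e = 1 \<Longrightarrow> c = 0"
    using d e by (simp_all add: c_def n_def)
  have n: "n \<noteq> 0" "n \<noteq> 1" using p by (auto simp: n_def)
  have t': "t \<in> klein_stab p (v = v') c" using t by (simp add: c_def)
  then have "t \<in> {0, 1, 2, 3}" using klein_stab_subset by blast
  show ?thesis
  proof (cases v)
    case v: True
    show ?thesis
    proof (cases "d = 0")
      case True
      then have "klein_add 0 t \<in> klein_stab p v' e"
        using t' c v \<open>t \<in> {0, 1, 2, 3}\<close> by (auto simp: klein_add_def)
      then show ?thesis using v by (auto simp: klein_stab_def)
    next
      case False
      then have "\<exists>r\<in>{0, 2}. klein_add r t \<in> klein_stab p v' e"
      proof (cases v')
        case True
        with v t' have "t \<in> {0, 2}" by (auto simp: klein_stab_def split: if_splits)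
        with True show ?thesis by (auto simp: klein_add_def klein_stab_def)
      next
        case v': False
        consider "e = 1" | "e \<noteq> 1" "e = n" | "e \<noteq> 1" "e \<noteq> n" by blast
        then show ?thesis
          using \<open>t \<in> {0, 1, 2, 3}\<close> v' unfolding klein_stab_def n_def[symmetric]
          by cases (auto simp: klein_add_def)
      qed
      then show ?thesis using v False by (simp add: klein_stab_def)
    qed
  next
    case v: False
    show ?thesis
    proof (cases v')
      case v': True
      show ?thesis
      proof (cases "e = 0")
        case True
        \<comment> \<open>\<open>N\<close> is trivial on the second coset, so \<open>r\<close> must
          cancel \<open>t\<close>.\<close>
        then have "klein_add t t = 0" "t \<in> klein_stab p v d"
          using t' c v v' \<open>t \<in> {0, 1, 2, 3}\<close> by (auto simp: klein_add_def)
        then show ?thesis using v v' by (intro bexI[of _ t]) (auto simp: klein_stab_def)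
      next
        case False
        consider "d = 1" | "d \<noteq> 1" "d = n" | "d \<noteq> 1" "d \<noteq> n" by blast
        then have "\<exists>r \<in> klein_stab p v d. - klein_add r t mod 4 \<in> {0, 2}"
          using v \<open>t \<in> {0, 1, 2, 3}\<close> unfolding klein_stab_def n_def[symmetric]
          by cases (auto simp: klein_add_def)
        then show ?thesis using v v' False by (simp add: klein_stab_def)
      qed
    next
      case v': False
      have "t = 0 \<or> t = 2 \<and> c \<noteq> 0"
        using t' v v' by (auto simp: klein_stab_def split: if_splits)
      then show ?thesis
      proof
        assume "t = 0"
        then show ?thesis
          using v v' by (intro bexI[of _ 0]) (auto simp: klein_stab_def klein_add_def)
      next
        \<comment> \<open>Here \<open>z\<close> must be a product of elements of \<open>N\<close>
          for \<open>d\<close> and of the conjugate of \<open>N\<close> for \<open>e\<close>. This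
          fails only if both are the same group of order 2, that is, if \<open>d\<close> and
          \<open>e\<close> are 1 and -1 in some order; then \<open>c = 0\<close>.\<close>
        assume "t = 2 \<and> c \<noteq> 0"
        then show ?thesis using v v' c n unfolding klein_stab_def n_def[symmetric]
          by (cases "d = 1"; cases "d = n"; cases "e = 1"; cases "e = n") (simp_all add: klein_add_def)
      qed
    qed
  qed
qed

text \<open>
  Moving \<open>x\<close> to \<open>t x\<close> is compensated by moving \<open>y\<close> to \<open>r y\<close>, where \<open>r \<in> N\<close> depends only on the coset
  \<open>V y\<close> and is provided by the previous lemma.
\<close>

lemma colour_pairs_klein_mult:
  fixes p defines "G \<equiv> D8_times_Z p"
  assumes p: "2 < p" and x: "((i, s), c) \<in> carrier G"
    and t: "t \<in> klein_stab p (odd i = s) c"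
  shows "image_mset (\<lambda>y. (twisted_colour p y, twisted_colour p (inv\<^bsub>G\<^esub> y \<otimes>\<^bsub>G\<^esub> ((i, s), c))))
      (mset_set (carrier G)) =
    image_mset (\<lambda>y. (twisted_colour p y,
        twisted_colour p (inv\<^bsub>G\<^esub> y \<otimes>\<^bsub>G\<^esub> (klein t \<otimes>\<^bsub>G\<^esub> ((i, s), c)))))
      (mset_set (carrier G))"
proof -
  interpret G: group G unfolding G_def by (rule group_D8_times_Z)
  have p0: "0 < p" using p by simp
  note kl = klein_closed[OF p0, folded G_def]
  have t4: "t \<in> {0, 1, 2, 3}" using t klein_stab_subset by blast
  \<comment> \<open>Both colours survive: \<open>r\<close> lies in \<open>N\<close> on the coset of
    \<open>y\<close>, and \<open>r t\<close> conjugated by \<open>y\<close> lies in \<open>N\<close>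
    on the coset of \<open>y^-1 x\<close>.\<close>
  define good where "good v d r \<longleftrightarrow> r \<in> klein_stab p v d \<and>
      (if v then klein_add r t else - klein_add r t mod 4) \<in>
        klein_stab p (v = (odd i = s)) ((c - d) mod int p)" for v d r
  have "\<exists>r. good v d r" if "d \<in> {0..<int p}" for v d
  proof (unfold good_def Bex_def[symmetric], rule klein_stab_mult[OF p that])
    have "c \<in> {0..<int p}" using x p0 by (simp add: G_def carrier_integer_mod_group)
    then have "(d + (c - d) mod int p) mod int p = c" by (simp add: mod_simps)
    moreover have "(v = (v = (odd i = s))) = (odd i = s)" by blast
    ultimately show "t \<in> klein_stab p (v = (v = (odd i = s))) ((d + (c - d) mod int p) mod int p)"
      using t by (simp only:)
  qed (use p0 in simp)
  then have \<tau>: "good v d (SOME r. good v d r)" if "d \<in> {0..<int p}" for v d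
    using that by (meson someI_ex)
  define \<tau> where "\<tau> v d = (SOME r. good v d r)" for v d
  note \<tau> = \<tau>[folded \<tau>_def]
  \<comment> \<open>This map is an involution: it stays in the coset \<open>V y\<close>, so a second
    application multiplies by the same \<open>r\<close>, and \<open>r r = 1\<close>.\<close>
  define \<sigma> where "\<sigma> = (\<lambda>((j, u), d). klein (\<tau> (odd j = u) d) \<otimes>\<^bsub>G\<^esub> ((j, u), d))"
  show ?thesis
  proof (rule image_mset_bij_cong[of _ \<sigma> \<sigma>])
    fix y assume y: "y \<in> carrier G"
    obtain j u d where y_eq: "y = ((j, u), d)" by (metis surj_pair)
    define v r where "v = (odd j = u)" and "r = \<tau> v d"
    have d: "d \<in> {0..<int p}" using y p0 by (simp add: y_eq G_def carrier_integer_mod_group)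
    have r: "r \<in> klein_stab p v d" using \<tau>[OF d, of v] by (simp add: good_def r_def)
    then have r4: "r \<in> {0, 1, 2, 3}" using klein_stab_subset by blast
    have \<sigma>y: "\<sigma> y = klein r \<otimes>\<^bsub>G\<^esub> y" by (simp add: \<sigma>_def y_eq r_def v_def)
    show "\<sigma> y \<in> carrier G" "\<sigma> y \<in> carrier G" unfolding \<sigma>y by (intro G.m_closed kl r4 y)+
    have \<sigma>y': "\<sigma> y = ((klein_add r j, odd r \<noteq> u), d)"
      unfolding \<sigma>y unfolding y_eq G_def by (rule klein_mult) (use y in \<open>simp add: y_eq G_def\<close>)
    have "odd (klein_add r j) = (odd r \<noteq> odd j)"
      unfolding klein_add_def by presburger
    then have "(odd (klein_add r j) = (odd r \<noteq> u)) = v" unfolding v_def by blast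
    then have "\<sigma> (\<sigma> y) = klein r \<otimes>\<^bsub>G\<^esub> \<sigma> y"
      unfolding \<sigma>y' by (simp only: \<sigma>_def r_def case_prod_conv)
    also have "\<dots> = (inv\<^bsub>G\<^esub> (klein r) \<otimes>\<^bsub>G\<^esub> klein r) \<otimes>\<^bsub>G\<^esub> y"
      unfolding \<sigma>y inv_klein[OF p0 r4, folded G_def]
      using kl[OF r4] y by (simp add: G.m_assoc)
    finally show "\<sigma> (\<sigma> y) = y" "\<sigma> (\<sigma> y) = y" using kl[OF r4] y by simp_all
    define t' where "t' = (if v then klein_add r t else - klein_add r t mod 4)"
    obtain k w e where ke: "inv\<^bsub>G\<^esub> y \<otimes>\<^bsub>G\<^esub> ((i, s), c) = ((k, w), e)" by (metis surj_pair)
    have kw: "k = (if u then j - i else i - j) mod 4" "w = (u \<noteq> s)" "e = (c - d) mod int p"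
      using ke inv_mult_D8_times_Z[of j u d p i s c] y unfolding y_eq G_def by simp_all
    have "odd k = w \<longleftrightarrow> v = (odd i = s)"
    proof -
      have "odd (m mod 4) \<longleftrightarrow> odd m" for m :: int by presburger
      then show ?thesis unfolding kw v_def by (cases u) auto
    qed
    then have t': "t' \<in> klein_stab p (odd k = w) e"
      using \<tau>[OF d, of v] unfolding t'_def r_def[symmetric] kw(3) good_def by simp
    then have t'4: "t' \<in> {0, 1, 2, 3}" using klein_stab_subset by blast
    have "inv\<^bsub>G\<^esub> \<sigma> y \<otimes>\<^bsub>G\<^esub> (klein t \<otimes>\<^bsub>G\<^esub> ((i, s), c)) =
        inv\<^bsub>G\<^esub> y \<otimes>\<^bsub>G\<^esub> ((klein r \<otimes>\<^bsub>G\<^esub> klein t) \<otimes>\<^bsub>G\<^esub> ((i, s), c))"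
      unfolding \<sigma>y using y x kl[OF r4] kl[OF t4] inv_klein[OF p0 r4, folded G_def]
      by (simp add: G.inv_mult_group G.m_assoc del: mult_DirProd)
    also have "klein r \<otimes>\<^bsub>G\<^esub> klein t = klein (klein_add r t)"
      unfolding G_def by (rule klein_mult_klein[OF p0 t4])
    also have "inv\<^bsub>G\<^esub> y \<otimes>\<^bsub>G\<^esub> (klein (klein_add r t) \<otimes>\<^bsub>G\<^esub> ((i, s), c)) =
        inv\<^bsub>G\<^esub> y \<otimes>\<^bsub>G\<^esub> (klein (klein_add r t) \<otimes>\<^bsub>G\<^esub> y) \<otimes>\<^bsub>G\<^esub> (inv\<^bsub>G\<^esub> y \<otimes>\<^bsub>G\<^esub> ((i, s), c))"
    proof -
      have "y \<otimes>\<^bsub>G\<^esub> (inv\<^bsub>G\<^esub> y \<otimes>\<^bsub>G\<^esub> ((i, s), c)) = ((i, s), c)"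
        using y x by (metis G.inv_closed G.l_one G.m_assoc G.r_inv)
      then show ?thesis
        using y x kl[OF klein_add_closed[of r t]] by (simp add: G.m_assoc)
    qed
    also have "klein (klein_add r t) \<otimes>\<^bsub>G\<^esub> y = y \<otimes>\<^bsub>G\<^esub> klein t'"
      unfolding t'_def v_def y_eq G_def
      by (rule klein_conj[OF _ klein_add_closed p0]) (use y in \<open>simp add: y_eq G_def\<close>)
    also have "inv\<^bsub>G\<^esub> y \<otimes>\<^bsub>G\<^esub> (y \<otimes>\<^bsub>G\<^esub> klein t') = klein t'"
      using y kl[OF t'4] by (metis G.inv_closed G.l_one G.m_assoc G.l_inv)
    finally have prod: "inv\<^bsub>G\<^esub> \<sigma> y \<otimes>\<^bsub>G\<^esub> (klein t \<otimes>\<^bsub>G\<^esub> ((i, s), c)) = klein t' \<otimes>\<^bsub>G\<^esub> ((k, w), e)"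
      unfolding ke .
    have "((k, w), e) \<in> carrier G" using y x unfolding ke[symmetric] by blast
    then have "twisted_colour p (klein t' \<otimes>\<^bsub>G\<^esub> ((k, w), e)) = twisted_colour p ((k, w), e)"
      unfolding G_def by (intro twisted_colour_klein_mult p t')
    moreover have "twisted_colour p (\<sigma> y) = twisted_colour p y"
      unfolding \<sigma>y using y r unfolding y_eq G_def v_def by (intro twisted_colour_klein_mult p)
    ultimately show "(twisted_colour p (\<sigma> y),
          twisted_colour p (inv\<^bsub>G\<^esub> \<sigma> y \<otimes>\<^bsub>G\<^esub> (klein t \<otimes>\<^bsub>G\<^esub> ((i, s), c)))) =
        (twisted_colour p y, twisted_colour p (inv\<^bsub>G\<^esub> y \<otimes>\<^bsub>G\<^esub> ((i, s), c)))"
      unfolding prod ke by simp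
  qed
qed

text \<open>\<open>(t x)^-1 = x^-1 t = t' x^-1\<close> with \<open>t'\<close> conjugate to
  \<open>t\<close>. Inversion interchanges the layers 1 and -1, and on \<open>V f\<close>
  conjugation interchanges \<langle>w\<rangle> and \<langle>w z\<rangle> accordingly.\<close>

lemma twisted_colour_inv:
  fixes p defines "G \<equiv> D8_times_Z p"
  assumes p: "2 < p" and x: "((i, s), c) \<in> carrier G" and t: "t \<in> klein_stab p (odd i = s) c"
  shows "twisted_colour p (inv\<^bsub>G\<^esub> (klein t \<otimes>\<^bsub>G\<^esub> ((i, s), c))) = twisted_colour p (inv\<^bsub>G\<^esub> ((i, s), c))"
proof -
  interpret G: group G unfolding G_def by (rule group_D8_times_Z)
  have p0: "0 < p" using p by simp
  have c: "0 \<le> c" "c < int p" using x p0 by (auto simp: G_def carrier_integer_mod_group)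
  have t4: "t \<in> {0, 1, 2, 3}" using t klein_stab_subset by blast
  define k e where "k = (if s then i else - i) mod 4" and "e = - c mod int p"
  have inv_x: "inv\<^bsub>G\<^esub> ((i, s), c) = ((k, s), e)"
    using inv_D8_times_Z[OF x[unfolded G_def]] unfolding G_def k_def e_def .
  then have mem: "((k, s), e) \<in> carrier G" using G.inv_closed[OF x] by simp
  have "odd (m mod 4) = odd m" for m :: int by presburger
  then have parity: "odd k = odd i" by (simp add: k_def)
  have "e = (if c = 0 then 0 else int p - c)"
    using c by (simp add: e_def zmod_zminus1_eq_if)
  then have e: "e = 0 \<longleftrightarrow> c = 0" "e = 1 \<longleftrightarrow> c = int p - 1" "e = int p - 1 \<longleftrightarrow> c = 1"
    using c p by auto
  define t' where "t' = (if odd i = s then t else - t mod 4)"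
  have t': "t' \<in> klein_stab p (odd k = s) e"
  proof (cases "odd i = s")
    case True
    then show ?thesis using t e(1) by (simp add: klein_stab_def t'_def parity)
  next
    case False
    consider "c = 1" "e = int p - 1" "e \<noteq> 1" | "c = int p - 1" "e = 1" "c \<noteq> 1"
      | "e \<noteq> 1" "e \<noteq> int p - 1"
      using e p by fastforce
    then show ?thesis
      using t t4 False by cases (auto simp: klein_stab_def t'_def parity)
  qed
  have t'4: "t' \<in> {0, 1, 2, 3}" using t' klein_stab_subset by blast
  have "(if odd k = s then t' else - t' mod 4) = t" using t4 by (auto simp: t'_def parity)
  then have "klein t' \<otimes>\<^bsub>G\<^esub> ((k, s), e) = ((k, s), e) \<otimes>\<^bsub>G\<^esub> klein t"
    using klein_conj[OF mem[unfolded G_def] t'4 p0] by (simp only: G_def)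
  also have "\<dots> = inv\<^bsub>G\<^esub> (klein t \<otimes>\<^bsub>G\<^esub> ((i, s), c))"
    unfolding inv_x[symmetric]
    using G.inv_mult_group[OF klein_closed[OF p0 t4, folded G_def] x] inv_klein[OF p0 t4, folded G_def]
    by simp
  finally show ?thesis
    using twisted_colour_klein_mult[OF p mem[unfolded G_def] t'] inv_x[unfolded G_def]
    unfolding G_def by simp
qed

lemma S_ring_twisted_colour:
  assumes p: "2 < p"
  shows "S_ring (D8_times_Z p) (colour_algebra (D8_times_Z p) (twisted_colour p))"
proof (rule S_ring_colour_algebra[OF group_D8_times_Z])
  have p0: "0 < p" using p by simp
  show "finite (carrier (D8_times_Z p))"
    unfolding carrier_D8_times_Z[OF p0] by simp
  fix x assume x: "x \<in> carrier (D8_times_Z p)"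
  obtain i s c where x_eq: "x = ((i, s), c)" by (metis surj_pair)
  note x = x[unfolded x_eq]
  have i: "i \<in> {0, 1, 2, 3}" using x unfolding carrier_D8_times_Z[OF p0] by simp
  show "x = \<one>\<^bsub>D8_times_Z p\<^esub>" if "twisted_colour p x = twisted_colour p \<one>\<^bsub>D8_times_Z p\<^esub>"
    using that i by (auto simp: x_eq twisted_colour_def dihedral_group_def split: if_splits)
  fix x' assume x': "x' \<in> carrier (D8_times_Z p)" and eq: "twisted_colour p x = twisted_colour p x'"
  obtain i' s' c' where x'_eq: "x' = ((i', s'), c')" by (metis surj_pair)
  obtain t where t: "t \<in> klein_stab p (odd i = s) c" "x' = klein t \<otimes>\<^bsub>D8_times_Z p\<^esub> x"
    using twisted_colour_eqD[OF p x x'[unfolded x'_eq] eq[unfolded x_eq x'_eq]]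
    unfolding x_eq x'_eq by blast
  show "twisted_colour p (inv\<^bsub>D8_times_Z p\<^esub> x) = twisted_colour p (inv\<^bsub>D8_times_Z p\<^esub> x')"
    unfolding t(2) unfolding x_eq by (rule twisted_colour_inv[OF p x t(1), symmetric])
  show "image_mset (\<lambda>y. (twisted_colour p y, twisted_colour p (inv\<^bsub>D8_times_Z p\<^esub> y \<otimes>\<^bsub>D8_times_Z p\<^esub> x)))
        (mset_set (carrier (D8_times_Z p))) =
      image_mset (\<lambda>y. (twisted_colour p y, twisted_colour p (inv\<^bsub>D8_times_Z p\<^esub> y \<otimes>\<^bsub>D8_times_Z p\<^esub> x')))
        (mset_set (carrier (D8_times_Z p)))"
    unfolding t(2) unfolding x_eq by (rule colour_pairs_klein_mult[OF p x t(1)])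
qed

section \<open>Non-schurity for odd \<open>p\<close>\<close>

lemma not_schurian_twisted_colour:
  fixes p defines "G \<equiv> D8_times_Z p"
  assumes p: "2 < p" "odd p"
  shows "\<not> schurian G (colour_algebra G (twisted_colour p))"
proof
  assume schurian: "schurian G (colour_algebra G (twisted_colour p))"
  have p0: "0 < p" using p by simp
  have carr: "carrier G = ({0, 1, 2, 3} \<times> UNIV) \<times> {0..<int p}"
    unfolding G_def by (rule carrier_D8_times_Z[OF p0])
  have mem: "((i, s), c) \<in> carrier G \<longleftrightarrow> i \<in> {0, 1, 2, 3} \<and> 0 \<le> c \<and> c < int p" for i s c
    by (auto simp: carr)
  have start: "((0, True), 0) \<in> carrier G" "((1, False), 0) \<in> carrier G"
    "twisted_colour p ((0, True), 0) = twisted_colour p ((1, False), 0)"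
    using p by (simp_all add: mem twisted_colour_def)
  obtain k where k_closed: "k \<in> carrier G \<rightarrow> carrier G" and k_one: "k ((0, False), 0) = ((0, False), 0)"
    and k_f: "k ((0, True), 0) = ((1, False), 0)"
    and rel: "\<And>i s c i' s' c' j u d j' u' d'.
      \<lbrakk>k ((i, s), c) = ((i', s'), c'); k ((j, u), d) = ((j', u'), d');
       ((i, s), c) \<in> carrier G; ((j, u), d) \<in> carrier G\<rbrakk> \<Longrightarrow>
      twisted_colour p (((if s' = u' then i' - j' else i' + j') mod 4, s' \<noteq> u'), (c' - d') mod int p) =
      twisted_colour p (((if s = u then i - j else i + j) mod 4, s \<noteq> u), (c - d) mod int p)"
    unfolding G_def
    by (rule schurian_D8_times_ZD[OF p0 schurian[unfolded G_def] start[unfolded G_def]]) blast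
  \<comment> \<open>Comparison with the fixed identity confines the image of \<open>(1, c)\<close>
    to \<langle>z\<rangle> in layer \<open>c\<close>.\<close>
  have P: "\<exists>a. k ((0, False), c) = ((a, False), c) \<and> a \<in> {0, 2}" if c: "0 \<le> c" "c < int p" for c
  proof -
    have c_mem: "((0, False), c) \<in> carrier G" using c by (simp add: mem)
    obtain a s c' where eq: "k ((0, False), c) = ((a, s), c')" by (metis surj_pair)
    then have a: "a \<in> {0, 1, 2, 3}" "0 \<le> c'" "c' < int p"
      using k_closed c_mem mem by (metis PiE)+
    then show ?thesis
      using rel[OF eq k_one c_mem] p0 c eq by (auto simp: mem twisted_colour_def split: if_splits)
  qed
  have Q: "\<exists>b. k ((0, True), c) = ((b, False), c) \<and> b \<in> {1, 3}" if c: "0 \<le> c" "c < int p" for c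
  proof -
    have c_mem: "((0, True), c) \<in> carrier G" using c by (simp add: mem)
    obtain b s c' where eq: "k ((0, True), c) = ((b, s), c')" by (metis surj_pair)
    then have b: "b \<in> {0, 1, 2, 3}" "0 \<le> c'" "c' < int p"
      using k_closed c_mem mem by (metis PiE)+
    then show ?thesis
      using rel[OF eq k_f c_mem] p0 c eq
      by (cases s) (auto simp: mem twisted_colour_def split: if_splits)
  qed
  have step: "k ((0, True), (c + 2) mod int p) = ((4 - b, False), (c + 2) mod int p)"
    if c: "0 \<le> c" "c < int p" and b: "k ((0, True), c) = ((b, False), c)" for b c
  proof -
    define d e where "d = (c + 1) mod int p" and "e = (c + 2) mod int p"
    have de: "0 \<le> d" "d < int p" "0 \<le> e" "e < int p" using p0 by (simp_all add: d_def e_def)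
    have diff: "(d - c) mod int p = 1" "(e - d) mod int p = 1"
      using p by (simp_all add: d_def e_def mod_simps)
    obtain a where a: "k ((0, False), d) = ((a, False), d)" "a \<in> {0, 2}" using P de by blast
    obtain b' where b': "k ((0, True), e) = ((b', False), e)" "b' \<in> {1, 3}" using Q de by blast
    have b13: "b \<in> {1, 3}" using Q[OF c] b by auto
    \<comment> \<open>The quotient of \<open>(1, d)\<close> by \<open>(f, c)\<close> is
      \<open>(f, 1)\<close>, with basic set \<open>{f, r}\<close> in layer 1. As
      \<open>a - b\<close> is odd, \<open>a = b + 1\<close> modulo 4. The quotient of
      \<open>(f, e)\<close> by \<open>(1, d)\<close> is also \<open>(f, 1)\<close>, so
      \<open>b' = a + 1\<close>, whence \<open>b' = b + 2\<close>, which is \<open>4 - b\<close> for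
      odd \<open>b\<close>.\<close>
    have "(a - b) mod 4 div 2 = 0"
      using rel[OF a(1) b] c de a(2) b13 by (auto simp: mem twisted_colour_def diff)
    moreover have "(b' - a) mod 4 div 2 = 0"
      using rel[OF b'(1) a(1)] de a(2) b'(2) by (auto simp: mem twisted_colour_def diff)
    ultimately have "b' = 4 - b" using a(2) b'(2) b13 by auto
    then show ?thesis using b'(1) by (simp add: e_def)
  qed
  have walk: "k ((0, True), int (2 * n) mod int p) =
      ((if even n then 1 else 3, False), int (2 * n) mod int p)" for n
  proof (induction n)
    case 0
    then show ?case using k_f by simp
  next
    case (Suc n)
    have "(int (2 * n) mod int p + 2) mod int p = int (2 * Suc n) mod int p"
      by (simp add: mod_simps add.commute)
    moreover have "4 - (if even n then 1 else 3) = (if even (Suc n) then 1 else 3 :: int)" by simp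
    ultimately show ?case using step[OF _ _ Suc] p0 by (simp only:) simp
  qed
  \<comment> \<open>The walk closes because \<open>2 p\<close> is 0 modulo \<open>p\<close>; an odd
    number of sign changes has occurred.\<close>
  have "k ((0, True), 0) = ((3, False), 0)" using walk[of p] p by simp
  then show False using k_f by simp
qed

section \<open>The prime 2\<close>

text \<open>Signs are written additively: \<open>0\<close> for \<open>1\<close> and \<open>1\<close> for \<open>-1\<close>.\<close>

definition hadamard_row :: "int \<Rightarrow> int" where
  "hadamard_row m = (if m mod 4 = 0 then 0 else 1)"

text \<open>\<open>X\<close> has colour \<open>(4, 0)\<close> and \<open>X c\<close> has
  \<open>(4, 1)\<close>; the tag 4 is not the index of a rotation.\<close>

definition hadamard_colour :: "(int \<times> bool) \<times> int \<Rightarrow> int \<times> int" where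
  "hadamard_colour = (\<lambda>((i, s), c).
     if s then (4, (hadamard_row i + c) mod 2)
     else if i = 0 then (0, c)
     else (i, 0))"

section \<open>Multiplication and inversion for the Hadamard colouring\<close>

lemma carrier_D8_times_Z2: "carrier (D8_times_Z 2) = ({0, 1, 2, 3} \<times> UNIV) \<times> {0, 1}"
  unfolding carrier_D8_times_Z[OF zero_less_numeral] by auto

text \<open>With the reindexing in coordinates, \<open>j\<close>, \<open>u\<close> and
  \<open>d\<close> take finitely many values and each condition is settled by evaluation.\<close>

lemma hadamard_colour_pairs_eqI:
  fixes \<sigma> \<sigma>' :: "(int \<times> bool) \<times> int \<Rightarrow> (int \<times> bool) \<times> int"
  defines "G \<equiv> D8_times_Z 2"
  assumes "\<And>j u d. j \<in> {0, 1, 2, 3} \<Longrightarrow> d \<in> {0, 1} \<Longrightarrow>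
      \<sigma> ((j, u), d) \<in> carrier G \<and> \<sigma>' ((j, u), d) \<in> carrier G \<and>
      \<sigma>' (\<sigma> ((j, u), d)) = ((j, u), d) \<and> \<sigma> (\<sigma>' ((j, u), d)) = ((j, u), d) \<and>
      hadamard_colour (\<sigma> ((j, u), d)) = hadamard_colour ((j, u), d)"
    and "\<And>j u d j' u' d'. j \<in> {0, 1, 2, 3} \<Longrightarrow> d \<in> {0, 1} \<Longrightarrow> \<sigma> ((j, u), d) = ((j', u'), d') \<Longrightarrow>
      hadamard_colour (((if u' then j' - i' else i' - j') mod 4, u' \<noteq> s'), (c' - d') mod 2) =
      hadamard_colour (((if u then j - i else i - j) mod 4, u \<noteq> s), (c - d) mod 2)"
  shows "image_mset (\<lambda>y. (hadamard_colour y, hadamard_colour (inv\<^bsub>G\<^esub> y \<otimes>\<^bsub>G\<^esub> ((i, s), c))))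
      (mset_set (carrier G)) =
    image_mset (\<lambda>y. (hadamard_colour y, hadamard_colour (inv\<^bsub>G\<^esub> y \<otimes>\<^bsub>G\<^esub> ((i', s'), c'))))
      (mset_set (carrier G))"
proof (rule image_mset_bij_cong[of _ \<sigma> \<sigma>'])
  fix y assume y: "y \<in> carrier G"
  then obtain j u d where y_eq: "y = ((j, u), d)" and j: "j \<in> {0, 1, 2, 3}" and d: "d \<in> {0, 1}"
    unfolding G_def carrier_D8_times_Z2 by blast
  obtain j' u' d' where \<sigma>y: "\<sigma> y = ((j', u'), d')" by (metis surj_pair)
  note basic = assms(2)[OF j d, of u, folded y_eq]
  show "\<sigma> y \<in> carrier G" "\<sigma>' y \<in> carrier G" "\<sigma>' (\<sigma> y) = y" "\<sigma> (\<sigma>' y) = y"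
    using basic by blast+
  show "(hadamard_colour (\<sigma> y), hadamard_colour (inv\<^bsub>G\<^esub> \<sigma> y \<otimes>\<^bsub>G\<^esub> ((i', s'), c'))) =
      (hadamard_colour y, hadamard_colour (inv\<^bsub>G\<^esub> y \<otimes>\<^bsub>G\<^esub> ((i, s), c)))"
    using basic assms(3)[OF j d \<sigma>y[unfolded y_eq]] y
      inv_mult_D8_times_Z[of j u d 2 i s c] inv_mult_D8_times_Z[of j' u' d' 2 i' s' c']
    unfolding \<sigma>y unfolding y_eq G_def by (simp del: carrier_DirProd)
qed

lemma hadamard_colour_pairs_rotation:
  fixes i :: int defines "G \<equiv> D8_times_Z 2"
  assumes i: "i \<in> {1, 2, 3}"
  shows "image_mset (\<lambda>y. (hadamard_colour y, hadamard_colour (inv\<^bsub>G\<^esub> y \<otimes>\<^bsub>G\<^esub> ((i, False), 0))))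
      (mset_set (carrier G)) =
    image_mset (\<lambda>y. (hadamard_colour y, hadamard_colour (inv\<^bsub>G\<^esub> y \<otimes>\<^bsub>G\<^esub> ((i, False), 1))))
      (mset_set (carrier G))"
proof -
  \<comment> \<open>Distinct rows of the Hadamard matrix are orthogonal: the signs at
    \<open>j\<close> and \<open>j - i\<close> agree for two indices \<open>j\<close> and differ for
    two. \<rho> exchanges these pairs, which compensates the factor \<open>c\<close>.\<close>
  define \<rho> where "\<rho> j = ((if i = 1 then 3 else 1) - j) mod 4" for j :: int
  define \<sigma> where "\<sigma> = (\<lambda>((j, u), d).
    if u then ((\<rho> j, True), (hadamard_row j + hadamard_row (\<rho> j) + d) mod 2)
    else ((j, False), if j = 0 then d else 1 - d))"
  show ?thesis
    unfolding G_def
  proof (rule hadamard_colour_pairs_eqI[of \<sigma> \<sigma>])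
    fix j d :: int and u assume j: "j \<in> {0, 1, 2, 3}" "d \<in> {0, 1}"
    show "\<sigma> ((j, u), d) \<in> carrier (D8_times_Z 2) \<and> \<sigma> ((j, u), d) \<in> carrier (D8_times_Z 2) \<and>
      \<sigma> (\<sigma> ((j, u), d)) = ((j, u), d) \<and> \<sigma> (\<sigma> ((j, u), d)) = ((j, u), d) \<and>
      hadamard_colour (\<sigma> ((j, u), d)) = hadamard_colour ((j, u), d)"
      unfolding carrier_D8_times_Z2 using j i
      by (elim insertE emptyE; cases u; simp add: \<sigma>_def \<rho>_def hadamard_row_def hadamard_colour_def)
    fix j' u' d' assume "\<sigma> ((j, u), d) = ((j', u'), d')"
    then show "hadamard_colour (((if u' then j' - i else i - j') mod 4, u' \<noteq> False), (1 - d') mod 2) =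
      hadamard_colour (((if u then j - i else i - j) mod 4, u \<noteq> False), (0 - d) mod 2)"
      using j i
      by (elim insertE emptyE; cases u; simp add: \<sigma>_def \<rho>_def hadamard_row_def hadamard_colour_def;
          elim conjE; simp add: hadamard_row_def)
  qed
qed

lemma hadamard_colour_pairs_reflection:
  fixes i :: int defines "G \<equiv> D8_times_Z 2"
  assumes i: "i \<in> {1, 2, 3}" and c: "c \<in> {0, 1}"
  shows "image_mset (\<lambda>y. (hadamard_colour y, hadamard_colour (inv\<^bsub>G\<^esub> y \<otimes>\<^bsub>G\<^esub> ((0, True), 1 - c))))
      (mset_set (carrier G)) =
    image_mset (\<lambda>y. (hadamard_colour y, hadamard_colour (inv\<^bsub>G\<^esub> y \<otimes>\<^bsub>G\<^esub> ((i, True), c))))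
      (mset_set (carrier G))"
proof -
  \<comment> \<open>Reflections are shifted by \<open>k\<close>, rotations keep their index, and the
    last coordinate is solved from the colour conditions. On rotations the terms cancel modulo 2 at
    \<open>j = 0\<close>, so \<open>1\<close> and \<open>c\<close> stay fixed as their colours
    require.\<close>
  define \<sigma> where "\<sigma> k = (\<lambda>((j, u), d).
    if u then (((j + k) mod 4, True), (hadamard_row j + hadamard_row (j + k) + d) mod 2)
    else ((j, False), (hadamard_row (- j) + hadamard_row (i - j) + hadamard_row i + d) mod 2))" for k
  show ?thesis
    unfolding G_def
  proof (rule hadamard_colour_pairs_eqI[of "\<sigma> i" "\<sigma> (- i)"])
    fix j d :: int and u assume j: "j \<in> {0, 1, 2, 3}" "d \<in> {0, 1}"
    show "\<sigma> i ((j, u), d) \<in> carrier (D8_times_Z 2) \<and> \<sigma> (- i) ((j, u), d) \<in> carrier (D8_times_Z 2) \<and>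
      \<sigma> (- i) (\<sigma> i ((j, u), d)) = ((j, u), d) \<and> \<sigma> i (\<sigma> (- i) ((j, u), d)) = ((j, u), d) \<and>
      hadamard_colour (\<sigma> i ((j, u), d)) = hadamard_colour ((j, u), d)"
      unfolding carrier_D8_times_Z2 using j i
      by (elim insertE emptyE; cases u; simp add: \<sigma>_def hadamard_row_def hadamard_colour_def)
    fix j' u' d' assume "\<sigma> i ((j, u), d) = ((j', u'), d')"
    then show "hadamard_colour (((if u' then j' - i else i - j') mod 4, u' \<noteq> True), (c - d') mod 2) =
      hadamard_colour (((if u then j - 0 else 0 - j) mod 4, u \<noteq> True), (1 - c - d) mod 2)"
      using j i c
      by (elim insertE emptyE; cases u; simp add: \<sigma>_def hadamard_row_def hadamard_colour_def;
          elim conjE; simp add: hadamard_row_def)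
  qed
qed

lemma S_ring_hadamard_colour: "S_ring (D8_times_Z 2) (colour_algebra (D8_times_Z 2) hadamard_colour)"
proof (rule S_ring_colour_algebra[OF group_D8_times_Z])
  define G where "G = D8_times_Z 2"
  define M where "M x = image_mset (\<lambda>y. (hadamard_colour y, hadamard_colour (inv\<^bsub>G\<^esub> y \<otimes>\<^bsub>G\<^esub> x)))
    (mset_set (carrier G))" for x
  \<comment> \<open>One representative per colour: it suffices to compare each element with the
    representative of its class.\<close>
  define rep :: "int \<times> int \<Rightarrow> (int \<times> bool) \<times> int" where
    "rep = (\<lambda>(a, b). if a = 4 then ((0, True), b) else ((a, False), b))"
  have M_rep: "M x = M (rep (hadamard_colour x))" if "x \<in> carrier (D8_times_Z 2)" for x
  proof -
    obtain i s c where x: "x = ((i, s), c)" and i: "i \<in> {0, 1, 2, 3}" and c: "c \<in> {0, 1}"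
      using \<open>x \<in> carrier (D8_times_Z 2)\<close> unfolding carrier_D8_times_Z2 by blast
    consider "i = 0" | "i \<in> {1, 2, 3}" "s" | "i \<in> {1, 2, 3}" "\<not> s" using i by blast
    then show ?thesis
    proof cases
      case 1
      then have "rep (hadamard_colour x) = x"
        using c by (auto simp: x rep_def hadamard_colour_def hadamard_row_def)
      then show ?thesis by simp
    next
      case 2
      then have "rep (hadamard_colour x) = ((0, True), 1 - c)"
        using c by (auto simp: x rep_def hadamard_colour_def hadamard_row_def)
      then show ?thesis
        using hadamard_colour_pairs_reflection[OF 2(1) c] 2(2) by (simp add: x M_def G_def)
    next
      case 3
      then have "rep (hadamard_colour x) = ((i, False), 0)"
        by (auto simp: x rep_def hadamard_colour_def)
      then show ?thesis
        using hadamard_colour_pairs_rotation[OF 3(1)] 3(2) c by (auto simp: x M_def G_def)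
    qed
  qed
  have inv_colour: "hadamard_colour (inv\<^bsub>D8_times_Z 2\<^esub> x) =
      (case hadamard_colour x of (a, b) \<Rightarrow> (if a = 4 then 4 else - a mod 4, b))"
    if mem: "x \<in> carrier (D8_times_Z 2)" for x
  proof -
    obtain i s c where x: "x = ((i, s), c)" and i: "i \<in> {0, 1, 2, 3}" "c \<in> {0, 1}"
      using mem unfolding carrier_D8_times_Z2 by blast
    then show ?thesis
      unfolding x inv_D8_times_Z[OF mem[unfolded x]]
      by (cases s) (auto simp: hadamard_colour_def hadamard_row_def)
  qed
  show "finite (carrier (D8_times_Z 2))" unfolding carrier_D8_times_Z2 by simp
  fix x assume x: "x \<in> carrier (D8_times_Z 2)"
  show "x = \<one>\<^bsub>D8_times_Z 2\<^esub>" if "hadamard_colour x = hadamard_colour \<one>\<^bsub>D8_times_Z 2\<^esub>"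
  proof -
    have "\<one>\<^bsub>D8_times_Z 2\<^esub> = ((0, False), 0)" by (simp add: dihedral_group_def)
    then show ?thesis
      using that x unfolding carrier_D8_times_Z2
      by (auto simp: hadamard_colour_def split: if_splits)
  qed
  fix x' assume x': "x' \<in> carrier (D8_times_Z 2)" and eq: "hadamard_colour x = hadamard_colour x'"
  show "hadamard_colour (inv\<^bsub>D8_times_Z 2\<^esub> x) = hadamard_colour (inv\<^bsub>D8_times_Z 2\<^esub> x')"
    unfolding inv_colour[OF x] inv_colour[OF x'] eq ..
  show "image_mset (\<lambda>y. (hadamard_colour y, hadamard_colour (inv\<^bsub>D8_times_Z 2\<^esub> y \<otimes>\<^bsub>D8_times_Z 2\<^esub> x)))
        (mset_set (carrier (D8_times_Z 2))) =
      image_mset (\<lambda>y. (hadamard_colour y, hadamard_colour (inv\<^bsub>D8_times_Z 2\<^esub> y \<otimes>\<^bsub>D8_times_Z 2\<^esub> x')))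
        (mset_set (carrier (D8_times_Z 2)))"
    using M_rep[OF x] M_rep[OF x'] eq unfolding M_def G_def by simp
qed

text \<open>Comparison with \<open>1\<close> and \<open>f c\<close> forces \<open>r\<close> to go to
  \<open>r c\<close> and \<open>r f\<close> to \<open>r^2 f\<close>. The quotient of
  \<open>r f\<close> by \<open>r\<close> is \<open>r^2 f\<close> in \<open>X c\<close>, but that of
  the images is \<open>r^3 f c\<close> in \<open>X\<close>.\<close>

lemma not_schurian_hadamard_colour:
  "\<not> schurian (D8_times_Z 2) (colour_algebra (D8_times_Z 2) hadamard_colour)"
proof
  let ?G = "D8_times_Z 2"
  assume schurian: "schurian ?G (colour_algebra ?G hadamard_colour)"
  have start: "((0, True), 1) \<in> carrier ?G" "((1, True), 0) \<in> carrier ?G"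
    "hadamard_colour ((0, True), 1) = hadamard_colour ((1, True), 0)"
    unfolding carrier_D8_times_Z2 by (simp_all add: hadamard_colour_def hadamard_row_def)
  obtain k where k_closed: "k \<in> carrier ?G \<rightarrow> carrier ?G" and k_one: "k ((0, False), 0) = ((0, False), 0)"
    and k_f: "k ((0, True), 1) = ((1, True), 0)"
    and rel: "\<And>i s c i' s' c' j u d j' u' d'.
      \<lbrakk>k ((i, s), c) = ((i', s'), c'); k ((j, u), d) = ((j', u'), d');
       ((i, s), c) \<in> carrier ?G; ((j, u), d) \<in> carrier ?G\<rbrakk> \<Longrightarrow>
      hadamard_colour (((if s' = u' then i' - j' else i' + j') mod 4, s' \<noteq> u'), (c' - d') mod int 2) =
      hadamard_colour (((if s = u then i - j else i + j) mod 4, s \<noteq> u), (c - d) mod int 2)"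
    by (rule schurian_D8_times_ZD[OF zero_less_numeral schurian start]) blast
  have mem: "((0, False), 0) \<in> carrier ?G" "((0, True), 1) \<in> carrier ?G"
    "((1, False), 0) \<in> carrier ?G" "((1, True), 0) \<in> carrier ?G"
    unfolding carrier_D8_times_Z2 by simp_all
  obtain i s c where r: "k ((1, False), 0) = ((i, s), c)" by (metis surj_pair)
  then have i: "i \<in> {0, 1, 2, 3}" "c \<in> {0, 1}"
    using k_closed mem(3) carrier_D8_times_Z2 by (metis PiE mem_Sigma_iff)+
  have r_val: "i = 1" "\<not> s" "c = 1"
  proof -
    show "\<not> s" "i = 1"
      using rel[OF r k_one mem(3,1)] i
      by (auto simp: hadamard_colour_def hadamard_row_def split: if_splits)
    then show "c = 1"
      using rel[OF r k_f mem(3,2)] i by (auto simp: hadamard_colour_def hadamard_row_def)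
  qed
  obtain j u d where rf: "k ((1, True), 0) = ((j, u), d)" by (metis surj_pair)
  then have j: "j \<in> {0, 1, 2, 3}" "d \<in> {0, 1}"
    using k_closed mem(4) carrier_D8_times_Z2 by (metis PiE mem_Sigma_iff)+
  have rf_val: "j = 2" "u" "d = 0"
  proof -
    show u using rel[OF rf k_one mem(4,1)] j by (auto simp: hadamard_colour_def hadamard_row_def split: if_splits)
    then show "j = 2"
      using rel[OF rf k_f mem(4,2)] j by (auto simp: hadamard_colour_def hadamard_row_def split: if_splits)
    with \<open>u\<close> show "d = 0"
      using rel[OF rf k_one mem(4,1)] j by (auto simp: hadamard_colour_def hadamard_row_def split: if_splits)
  qed
  show False
    using rel[OF rf r mem(4,3)] r_val rf_val by (simp add: hadamard_colour_def hadamard_row_def)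
qed

theorem proposition3p1:
  fixes p :: nat
  assumes "Factorial_Ring.prime p"
  shows "\<not> Schur_group (D\<^sub>8 \<times>\<times> integer_mod_group p)"
proof (cases "p = 2")
  case True
  then show ?thesis
    using S_ring_hadamard_colour not_schurian_hadamard_colour unfolding Schur_group_def by blast
next
  case False
  then have "2 < p" "odd p"
    using prime_ge_2_nat[OF assms] prime_odd_nat[OF assms] by simp_all
  then show ?thesis
    using S_ring_twisted_colour not_schurian_twisted_colour unfolding Schur_group_def by blast
qed

end
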